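(* Let $\lambda$ be a nonzero real number and let $Y$ be a real random variable whose moment generating function exists in a neighborhood of the origin and such that $E[Y]\neq 0$. Then the following hold. (a) For all integers $n,l\ge 0$, $$\sum_{k=l}^{n} S_{2,\lambda}^{Y}(n,k)S_{1,\lambda}^{Y}(k,l)=\delta_{n,l},\qquad \sum_{k=l}^{n} S_{1,\lambda}^{Y}(n,k)S_{2,\lambda}^{Y}(k,l)=\delta_{n,l}.$$ (b) For any sequences $(a_n)_{n\ge 0}$, $(b_n)_{n\ge 0}$ of complex numbers, $$a_{n}=\sum_{k=0}^{n}S_{2,\lambda}^{Y}(n,k) b_{k}\ \text{ for all } n\ge 0 \iff b_{n}=\sum_{k=0}^{n}S_{1,\lambda}^{Y}(n,k)a_{k}\ \text{ for all } n\ge 0.$$ (c) For any integer $m\ge 0$ and any complex numbers $a_0,\dots,a_m,b_0,\dots,b_m$, $$a_{n}=\sum_{k=n}^{m}S_{2,\lambda}^{Y}(k,n)b_{k}\ \text{ for all } 0\le n\le m \iff b_{n}=\sum_{k=n}^{m}S_{1,\lambda}^{Y}(k,n)a_{k}\ \text{ for all } 0\le n\le m.$$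
   Context: Existence of the moment generating function near the origin means that for some $r>0$, $E[e^{Yt}]=\sum_{n\ge 0}E[Y^n]\frac{t^n}{n!}$ exists for $|t|<r$. The degenerate falling factorials are $(x)_{0,\lambda}=1$, $(x)_{n,\lambda}=x(x-\lambda)\cdots(x-(n-1)\lambda)$ for $n\ge1$, and the degenerate exponentials are $e_\lambda^x(t)=(1+\lambda t)^{x/\lambda}=\sum_{n\ge 0}(x)_{n,\lambda}\frac{t^n}{n!}$. Put $e_{Y,\lambda}(t)=E[e_\lambda^Y(t)]-1=\sum_{n\ge 1}E[(Y)_{n,\lambda}]\frac{t^n}{n!}$ (as a power series in $t$); since its linear coefficient is $E[Y]\ne 0$, it has a compositional inverse $\bar e_{Y,\lambda}(t)$. The probabilistic degenerate Stirling numbers of the second kind $S_{2,\lambda}^Y(n,k)$ and of the first kind $S_{1,\lambda}^Y(n,k)$ associated with $Y$ are defined, for $k\ge 0$, by $$\frac{1}{k!}\big(e_{Y,\lambda}(t)\big)^k=\sum_{n=k}^\infty S_{2,\lambda}^Y(n,k)\frac{t^n}{n!},\qquad \frac{1}{k!}\big(\bar e_{Y,\lambda}(t)\big)^k=\sum_{n=k}^\infty S_{1,\lambda}^Y(n,k)\frac{t^n}{n!},$$ and are $0$ if $k>n$ or $k<0$. $\delta_{n,l}$ is the Kronecker delta; empty sums are $0$. *)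

theory Defs
  imports "HOL-Probability.Probability" "HOL-Computational_Algebra.Computational_Algebra"
begin

definition mgf_exists_near_0 :: "'a measure \<Rightarrow> ('a \<Rightarrow> real) \<Rightarrow> bool" where
  "mgf_exists_near_0 M Y \<longleftrightarrow>
     (\<exists>r>0. \<forall>t. \<bar>t\<bar> < r \<longrightarrow> integrable M (\<lambda>\<omega>. exp (Y \<omega> * t)))"

text \<open>
  Only the existence of the expectation of \<open>exp (Y t)\<close> is demanded above; existence of all
  moments and convergence of the moment series to the moment generating function follow from it.
\<close>

lemma mgf_series:
  fixes Y :: "'a \<Rightarrow> real"
  assumes Y: "Y \<in> borel_measurable M" and mgf: "mgf_exists_near_0 M Y"
  shows "\<exists>r>0. \<forall>t. \<bar>t\<bar> < r \<longrightarrow> integrable M (\<lambda>\<omega>. exp (Y \<omega> * t)) \<and>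
           (\<forall>n. integrable M (\<lambda>\<omega>. Y \<omega> ^ n)) \<and>
           (\<lambda>n. (\<integral>\<omega>. Y \<omega> ^ n \<partial>M) * t ^ n / fact n) sums (\<integral>\<omega>. exp (Y \<omega> * t) \<partial>M)"
proof -
  obtain r where r: "r > 0" and int: "\<And>t. \<bar>t\<bar> < r \<Longrightarrow> integrable M (\<lambda>\<omega>. exp (Y \<omega> * t))"
    using mgf unfolding mgf_exists_near_0_def by blast
  have expabs: "integrable M (\<lambda>\<omega>. exp (\<bar>Y \<omega>\<bar> * s))" if s: "0 \<le> s" "s < r" for s
  proof (rule Bochner_Integration.integrable_bound)
    show "integrable M (\<lambda>\<omega>. exp (Y \<omega> * s) + exp (Y \<omega> * (- s)))"
      using int[of s] int[of "- s"] s by (intro Bochner_Integration.integrable_add) auto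
    show "(\<lambda>\<omega>. exp (\<bar>Y \<omega>\<bar> * s)) \<in> borel_measurable M" using Y by measurable
    show "AE \<omega> in M. norm (exp (\<bar>Y \<omega>\<bar> * s)) \<le> norm (exp (Y \<omega> * s) + exp (Y \<omega> * (- s)))"
    proof (rule AE_I2)
      fix \<omega>
      have "exp (\<bar>Y \<omega>\<bar> * s) \<le> exp (Y \<omega> * s) + exp (Y \<omega> * (- s))"
        by (cases "Y \<omega> < 0") auto
      then show "norm (exp (\<bar>Y \<omega>\<bar> * s)) \<le> norm (exp (Y \<omega> * s) + exp (Y \<omega> * (- s)))"
        by simp
    qed
  qed
  have exp_sums: "(\<lambda>n. x ^ n / fact n) sums exp x" for x :: real
    using exp_converges[of x] by (simp add: scaleR_conv_of_real field_simps)
  have term_le: "x ^ n / fact n \<le> exp x" if "0 \<le> x" for x :: real and n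
    using sum_le_suminf[OF sums_summable[OF exp_sums[of x]], of "{n}"] that
      sums_unique[OF exp_sums[of x]] by simp
  have mom: "integrable M (\<lambda>\<omega>. Y \<omega> ^ n)" for n
  proof (rule Bochner_Integration.integrable_bound)
    define s where "s = r / 2"
    have s: "0 < s" "s < r" using r by (auto simp: s_def)
    show "integrable M (\<lambda>\<omega>. fact n / s ^ n * exp (\<bar>Y \<omega>\<bar> * s))"
      using expabs[of s] s by (intro integrable_mult_right) auto
    show "(\<lambda>\<omega>. Y \<omega> ^ n) \<in> borel_measurable M" using Y by measurable
    show "AE \<omega> in M. norm (Y \<omega> ^ n) \<le> norm (fact n / s ^ n * exp (\<bar>Y \<omega>\<bar> * s))"
    proof (rule AE_I2)
      fix \<omega>
      show "norm (Y \<omega> ^ n) \<le> norm (fact n / s ^ n * exp (\<bar>Y \<omega>\<bar> * s))"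
        using term_le[of "\<bar>Y \<omega>\<bar> * s" n] s
        by (simp add: power_abs power_mult_distrib field_simps abs_mult)
    qed
  qed
  have ser: "(\<lambda>n. (\<integral>\<omega>. Y \<omega> ^ n \<partial>M) * t ^ n / fact n) sums (\<integral>\<omega>. exp (Y \<omega> * t) \<partial>M)"
    if t: "\<bar>t\<bar> < r" for t
  proof -
    define f where "f = (\<lambda>n \<omega>. (Y \<omega> * t) ^ n / fact n)"
    have fi: "integrable M (f n)" for n
      unfolding f_def power_mult_distrib using mom[of n] by auto
    have nf: "(\<lambda>n. norm (f n \<omega>)) sums exp (\<bar>Y \<omega>\<bar> * \<bar>t\<bar>)" for \<omega>
      using exp_sums[of "\<bar>Y \<omega>\<bar> * \<bar>t\<bar>"] by (simp add: f_def abs_mult power_abs)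
    have "(\<lambda>n. integral\<^sup>L M (f n)) sums (\<integral>\<omega>. (\<Sum>n. f n \<omega>) \<partial>M)"
    proof (rule sums_integral)
      show "integrable M (f n)" for n by (rule fi)
      show "AE \<omega> in M. summable (\<lambda>n. norm (f n \<omega>))"
        using nf sums_summable by blast
      show "summable (\<lambda>n. \<integral>\<omega>. norm (f n \<omega>) \<partial>M)"
      proof (rule bounded_imp_summable)
        show "0 \<le> (\<integral>\<omega>. norm (f n \<omega>) \<partial>M)" for n by simp
        show "(\<Sum>k\<le>n. \<integral>\<omega>. norm (f k \<omega>) \<partial>M) \<le> (\<integral>\<omega>. exp (\<bar>Y \<omega>\<bar> * \<bar>t\<bar>) \<partial>M)" for n
        proof -
          have "(\<Sum>k\<le>n. \<integral>\<omega>. norm (f k \<omega>) \<partial>M) = (\<integral>\<omega>. (\<Sum>k\<le>n. norm (f k \<omega>)) \<partial>M)"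
            using fi by (simp add: Bochner_Integration.integral_sum)
          also have "\<dots> \<le> (\<integral>\<omega>. exp (\<bar>Y \<omega>\<bar> * \<bar>t\<bar>) \<partial>M)"
          proof (rule integral_mono)
            show "integrable M (\<lambda>\<omega>. \<Sum>k\<le>n. norm (f k \<omega>))" using fi by auto
            show "integrable M (\<lambda>\<omega>. exp (\<bar>Y \<omega>\<bar> * \<bar>t\<bar>))" using expabs[of "\<bar>t\<bar>"] t by simp
            show "(\<Sum>k\<le>n. norm (f k \<omega>)) \<le> exp (\<bar>Y \<omega>\<bar> * \<bar>t\<bar>)" for \<omega>
              using sum_le_suminf[OF sums_summable[OF nf[of \<omega>]], of "{..n}"]
                sums_unique[OF nf[of \<omega>]] by simp
          qed
          finally show ?thesis .
        qed
      qed
    qed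
    moreover have "(\<Sum>n. f n \<omega>) = exp (Y \<omega> * t)" for \<omega>
      using sums_unique[OF exp_sums[of "Y \<omega> * t"]] by (simp add: f_def)
    moreover have "integral\<^sup>L M (f n) = (\<integral>\<omega>. Y \<omega> ^ n \<partial>M) * t ^ n / fact n" for n
      by (simp add: f_def power_mult_distrib)
    ultimately show ?thesis by simp
  qed
  show ?thesis using r int mom ser by blast
qed

definition degen_ffact :: "real \<Rightarrow> real \<Rightarrow> nat \<Rightarrow> real" where
  "degen_ffact lam x n = (\<Prod>i<n. x - real i * lam)"

definition degen_exp :: "real \<Rightarrow> real \<Rightarrow> real fps" where
  "degen_exp lam x = Abs_fps (\<lambda>n. degen_ffact lam x n / fact n)"

lemma degen_exp_sums:
  assumes "lam \<noteq> 0" and "\<bar>lam * t\<bar> < 1"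
  shows "(\<lambda>n. degen_exp lam x $ n * t ^ n) sums (1 + lam * t) powr (x / lam)"
proof -
  have "((x / lam) gchoose n) * (lam * t) ^ n = degen_exp lam x $ n * t ^ n" for n
  proof -
    have "(\<Prod>i<n. x / lam - real i) * lam ^ n = (\<Prod>i<n. (x / lam - real i) * lam)"
      by (simp add: prod.distrib)
    also have "\<dots> = degen_ffact lam x n"
      using assms(1) by (simp add: degen_ffact_def left_diff_distrib)
    finally show ?thesis
      by (simp add: gbinomial_prod_rev degen_exp_def power_mult_distrib lessThan_atLeast0)
  qed
  then show ?thesis
    using gen_binomial_real[of "lam * t" "x / lam"] assms(2) by (simp add: sums_def)
qed

text \<open>The expectation of the power series is taken coefficientwise.\<close>

definition prob_degen_exp :: "real \<Rightarrow> 'a measure \<Rightarrow> ('a \<Rightarrow> real) \<Rightarrow> real fps" where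
  "prob_degen_exp lam M Y = Abs_fps (\<lambda>n. \<integral>\<omega>. degen_exp lam (Y \<omega>) $ n \<partial>M) - 1"

lemma prob_degen_exp_nth:
  assumes "prob_space M"
  shows "prob_degen_exp lam M Y $ n =
           (if n = 0 then 0 else (\<integral>\<omega>. degen_ffact lam (Y \<omega>) n \<partial>M) / fact n)"
  using prob_space.prob_space[OF assms]
  by (simp add: prob_degen_exp_def degen_exp_def degen_ffact_def)

lemma prob_degen_exp_nth_1:
  assumes "prob_space M"
  shows "prob_degen_exp lam M Y $ 1 = (\<integral>\<omega>. Y \<omega> \<partial>M)"
  using assms by (simp add: prob_degen_exp_nth degen_ffact_def)

text \<open>
  Below, \<open>fps_inv\<close> is the compositional inverse, which is meaningful because the constant
  coefficient of \<open>prob_degen_exp\<close> is \<open>0\<close> and its linear coefficient is the expectation of \<open>Y\<close>.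
\<close>

definition prob_degen_stirling2 ::
    "real \<Rightarrow> 'a measure \<Rightarrow> ('a \<Rightarrow> real) \<Rightarrow> nat \<Rightarrow> nat \<Rightarrow> real" where
  "prob_degen_stirling2 lam M Y n k =
     fact n * (fps_const (1 / fact k) * prob_degen_exp lam M Y ^ k) $ n"

definition prob_degen_stirling1 ::
    "real \<Rightarrow> 'a measure \<Rightarrow> ('a \<Rightarrow> real) \<Rightarrow> nat \<Rightarrow> nat \<Rightarrow> real" where
  "prob_degen_stirling1 lam M Y n k =
     fact n * (fps_const (1 / fact k) * fps_inv (prob_degen_exp lam M Y) ^ k) $ n"

lemma prob_degen_stirling2_eq_0:
  assumes "prob_space M" and "n < k"
  shows "prob_degen_stirling2 lam M Y n k = 0"
  using assms startsby_zero_power_prefix[of "prob_degen_exp lam M Y" k]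
  by (simp add: prob_degen_stirling2_def prob_degen_exp_nth)

lemma prob_degen_stirling1_eq_0:
  assumes "n < k"
  shows "prob_degen_stirling1 lam M Y n k = 0"
  using assms startsby_zero_power_prefix[of "fps_inv (prob_degen_exp lam M Y)" k]
  by (simp add: prob_degen_stirling1_def fps_inv_def)

end

theory Submission
  imports Defs
begin

text \<open>
  For a power series \<open>f\<close> without constant term, the numbers
  \<open>B\<^sub>f(n, k) = n! [t\<^sup>n] f\<^sup>k / k!\<close> form a lower triangular matrix, and this matrix
  turns composition into multiplication: expanding \<open>(g \<circ> f)\<^sup>l = g\<^sup>l \<circ> f\<close> in powers
  of \<open>f\<close> gives \<open>B\<^sub>f B\<^sub>g = B\<^bsub>g \<circ> f\<^esub>\<close> (\<open>bell_matrix_compose\<close>).  The Stirling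
  numbers of the second and first kind are the entries of \<open>B\<^sub>f\<close> and \<open>B\<^sub>g\<close> for
  \<open>f = prob_degen_exp lam M Y\<close> and its compositional inverse \<open>g\<close>.  Both compositions of
  \<open>f\<close> and \<open>g\<close> are the identity series, whose matrix is the identity matrix.  So the two
  Stirling matrices are mutually inverse, which is (a).

  Parts (b) and (c) say that multiplying a column vector by one matrix is undone by the other:
  in (b) for the matrices themselves, in (c) for the transposes of their leading
  \<open>(m + 1) \<times> (m + 1)\<close> blocks (\<open>lower_triangular_inversion\<close>,
  \<open>lower_triangular_transpose_inversion\<close>).  Triangularity keeps every sum finite and makes
  the leading blocks inverse to each other as well.

  Probability enters through the first two coefficients of \<open>f\<close>: the constant one is
  \<open>0\<close> because the total mass is \<open>1\<close>, and the linear one is the expectation of \<open>Y\<close>,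
  which is nonzero, so that the compositional inverse exists.
\<close>

definition bell_matrix :: "'a::field_char_0 fps \<Rightarrow> nat \<Rightarrow> nat \<Rightarrow> 'a" where
  "bell_matrix f n k = fact n * (fps_const (1 / fact k) * f ^ k) $ n"

lemma prob_degen_stirling2_eq_bell_matrix:
  "prob_degen_stirling2 lam M Y = bell_matrix (prob_degen_exp lam M Y)"
  by (intro ext) (simp add: prob_degen_stirling2_def bell_matrix_def)

lemma prob_degen_stirling1_eq_bell_matrix:
  "prob_degen_stirling1 lam M Y = bell_matrix (fps_inv (prob_degen_exp lam M Y))"
  by (intro ext) (simp add: prob_degen_stirling1_def bell_matrix_def)

lemma bell_matrix_fps_X: "bell_matrix fps_X n l = (if n = l then 1 else 0)"
  by (simp add: bell_matrix_def fps_X_power_nth)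

text \<open>
  The coefficient of \<open>t\<^sup>n\<close> in \<open>g\<^sup>l \<circ> f\<close> is the sum of \<open>[t\<^sup>k] g\<^sup>l \<cdot> [t\<^sup>n] f\<^sup>k\<close>
  over \<open>k \<le> n\<close>.  The terms with \<open>k < l\<close> vanish because \<open>g\<close> has no constant term, and
  the factors \<open>k!\<close> of the two matrices cancel.
\<close>

lemma bell_matrix_compose:
  fixes f g :: "'a::field_char_0 fps"
  assumes f: "f $ 0 = 0" and g: "g $ 0 = 0"
  shows "(\<Sum>k=l..n. bell_matrix f n k * bell_matrix g k l) = bell_matrix (g oo f) n l"
proof -
  have "(\<Sum>k=l..n. bell_matrix f n k * bell_matrix g k l)
      = (\<Sum>k=l..n. fact n / fact l * ((g ^ l) $ k * (f ^ k) $ n))"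
    by (intro sum.cong refl) (simp add: bell_matrix_def)
  also have "\<dots> = (\<Sum>k=0..n. fact n / fact l * ((g ^ l) $ k * (f ^ k) $ n))"
    by (intro sum.mono_neutral_left) (auto simp: startsby_zero_power_prefix[OF g])
  also have "\<dots> = fact n / fact l * ((g ^ l) oo f) $ n"
    by (simp add: fps_compose_nth sum_distrib_left)
  also have "\<dots> = bell_matrix (g oo f) n l"
    by (simp add: bell_matrix_def fps_compose_power[OF f])
  finally show ?thesis .
qed

lemma bell_matrix_fps_inv_right:
  fixes f :: "'a::field_char_0 fps"
  assumes f: "f $ 0 = 0" "f $ 1 \<noteq> 0"
  shows "(\<Sum>k=l..n. bell_matrix f n k * bell_matrix (fps_inv f) k l) = (if n = l then 1 else 0)"
proof -
  have "fps_inv f $ 0 = 0" by (simp add: fps_inv_def)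
  then show ?thesis
    using f by (simp add: bell_matrix_compose fps_inv bell_matrix_fps_X)
qed

lemma bell_matrix_fps_inv_left:
  fixes f :: "'a::field_char_0 fps"
  assumes f: "f $ 0 = 0" "f $ 1 \<noteq> 0"
  shows "(\<Sum>k=l..n. bell_matrix (fps_inv f) n k * bell_matrix f k l) = (if n = l then 1 else 0)"
proof -
  have "fps_inv f $ 0 = 0" by (simp add: fps_inv_def)
  then show ?thesis
    using f by (simp add: bell_matrix_compose fps_inv_right bell_matrix_fps_X)
qed

text \<open>
  One half of each inversion formula is associativity of the matrix product,
  \<open>B (A x) = (B A) x = x\<close>.  Only the entries on and below the diagonal occur, so a lower
  triangular matrix is represented by an arbitrary function of two indices.  The other half follows
  by exchanging the two matrices.
\<close>

lemma lower_triangular_left_inverse_apply: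
  fixes A B :: "nat \<Rightarrow> nat \<Rightarrow> 'a::comm_ring_1"
  assumes BA: "\<And>n l. (\<Sum>k=l..n. B n k * A k l) = (if n = l then 1 else 0)"
    and y: "\<And>n. y n = (\<Sum>k=0..n. A n k * x k)"
  shows "x n = (\<Sum>k=0..n. B n k * y k)"
proof -
  have "(\<Sum>k=0..n. B n k * y k) = (\<Sum>k\<in>{0..n}. \<Sum>l | l \<in> {0..n} \<and> l \<le> k. B n k * A k l * x l)"
    unfolding y sum_distrib_left by (intro sum.cong) (auto simp: mult.assoc)
  also have "\<dots> = (\<Sum>l\<in>{0..n}. \<Sum>k | k \<in> {0..n} \<and> l \<le> k. B n k * A k l * x l)"
    by (rule sum.swap_restrict) auto
  also have "\<dots> = (\<Sum>l\<in>{0..n}. (\<Sum>k=l..n. B n k * A k l) * x l)"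
    unfolding sum_distrib_right by (intro sum.cong) auto
  also have "\<dots> = x n"
    by (simp add: BA if_distrib[of "\<lambda>c. c * _"] cong: if_cong)
  finally show ?thesis by simp
qed

lemma lower_triangular_transpose_right_inverse_apply:
  fixes A B :: "nat \<Rightarrow> nat \<Rightarrow> 'a::comm_ring_1"
  assumes AB: "\<And>n l. (\<Sum>k=l..n. A n k * B k l) = (if n = l then 1 else 0)"
    and y: "\<And>n. n \<le> m \<Longrightarrow> y n = (\<Sum>k=n..m. A k n * x k)"
    and n: "n \<le> m"
  shows "x n = (\<Sum>k=n..m. B k n * y k)"
proof -
  have "(\<Sum>k=n..m. B k n * y k) = (\<Sum>k\<in>{n..m}. \<Sum>l | l \<in> {n..m} \<and> k \<le> l. A l k * B k n * x l)"
    by (intro sum.cong refl)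
       (auto simp: y sum_distrib_left mult_ac intro!: sum.cong)
  also have "\<dots> = (\<Sum>l\<in>{n..m}. \<Sum>k | k \<in> {n..m} \<and> k \<le> l. A l k * B k n * x l)"
    by (rule sum.swap_restrict) auto
  also have "\<dots> = (\<Sum>l\<in>{n..m}. (\<Sum>k=n..l. A l k * B k n) * x l)"
    unfolding sum_distrib_right by (intro sum.cong) auto
  also have "\<dots> = x n"
    using n by (simp add: AB if_distrib[of "\<lambda>c. c * _"] cong: if_cong)
  finally show ?thesis by simp
qed

lemma lower_triangular_inversion:
  fixes A B :: "nat \<Rightarrow> nat \<Rightarrow> 'a::comm_ring_1"
  assumes "\<And>n l. (\<Sum>k=l..n. A n k * B k l) = (if n = l then 1 else 0)"
    and "\<And>n l. (\<Sum>k=l..n. B n k * A k l) = (if n = l then 1 else 0)"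
  shows "(\<forall>n. y n = (\<Sum>k=0..n. A n k * x k)) \<longleftrightarrow> (\<forall>n. x n = (\<Sum>k=0..n. B n k * y k))"
  using lower_triangular_left_inverse_apply[of B A y x]
    lower_triangular_left_inverse_apply[of A B x y] assms by blast

lemma lower_triangular_transpose_inversion:
  fixes A B :: "nat \<Rightarrow> nat \<Rightarrow> 'a::comm_ring_1"
  assumes "\<And>n l. (\<Sum>k=l..n. A n k * B k l) = (if n = l then 1 else 0)"
    and "\<And>n l. (\<Sum>k=l..n. B n k * A k l) = (if n = l then 1 else 0)"
  shows "(\<forall>n\<le>m. y n = (\<Sum>k=n..m. A k n * x k)) \<longleftrightarrow> (\<forall>n\<le>m. x n = (\<Sum>k=n..m. B k n * y k))"
  using lower_triangular_transpose_right_inverse_apply[of A B m y x]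
    lower_triangular_transpose_right_inverse_apply[of B A m x y] assms by blast

theorem proposition1p2:
  fixes lam :: real and M :: "'a measure" and Y :: "'a \<Rightarrow> real"
  assumes "lam \<noteq> 0"
    and "prob_space M"
    and "Y \<in> borel_measurable M"
    and "mgf_exists_near_0 M Y"
    and "(\<integral>\<omega>. Y \<omega> \<partial>M) \<noteq> 0"
  shows
    "(\<forall>n l::nat.
        (\<Sum>k=l..n. prob_degen_stirling2 lam M Y n k * prob_degen_stirling1 lam M Y k l)
          = (if n = l then 1 else 0) \<and>
        (\<Sum>k=l..n. prob_degen_stirling1 lam M Y n k * prob_degen_stirling2 lam M Y k l)
          = (if n = l then 1 else 0)) \<and>
     (\<forall>a b :: nat \<Rightarrow> complex.
        (\<forall>n. a n = (\<Sum>k=0..n. of_real (prob_degen_stirling2 lam M Y n k) * b k)) \<longleftrightarrow>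
        (\<forall>n. b n = (\<Sum>k=0..n. of_real (prob_degen_stirling1 lam M Y n k) * a k))) \<and>
     (\<forall>m::nat. \<forall>a b :: nat \<Rightarrow> complex.
        (\<forall>n\<le>m. a n = (\<Sum>k=n..m. of_real (prob_degen_stirling2 lam M Y k n) * b k)) \<longleftrightarrow>
        (\<forall>n\<le>m. b n = (\<Sum>k=n..m. of_real (prob_degen_stirling1 lam M Y k n) * a k)))"
proof -
  let ?f = "prob_degen_exp lam M Y"
  let ?S2 = "prob_degen_stirling2 lam M Y" and ?S1 = "prob_degen_stirling1 lam M Y"
  have f0: "?f $ 0 = 0" and f1: "?f $ 1 \<noteq> 0"
    using assms(5) prob_degen_exp_nth[OF assms(2), of lam Y 0]
      prob_degen_exp_nth_1[OF assms(2), of lam Y] by simp_all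
  have S21: "(\<Sum>k=l..n. ?S2 n k * ?S1 k l) = (if n = l then 1 else 0)" for n l
    unfolding prob_degen_stirling2_eq_bell_matrix prob_degen_stirling1_eq_bell_matrix
    by (rule bell_matrix_fps_inv_right[OF f0 f1])
  have S12: "(\<Sum>k=l..n. ?S1 n k * ?S2 k l) = (if n = l then 1 else 0)" for n l
    unfolding prob_degen_stirling2_eq_bell_matrix prob_degen_stirling1_eq_bell_matrix
    by (rule bell_matrix_fps_inv_left[OF f0 f1])
  have cS21: "(\<Sum>k=l..n. complex_of_real (?S2 n k) * complex_of_real (?S1 k l))
      = (if n = l then 1 else 0)" for n l
    using arg_cong[OF S21[where n=n and l=l], of complex_of_real] by (auto split: if_splits)
  have cS12: "(\<Sum>k=l..n. complex_of_real (?S1 n k) * complex_of_real (?S2 k l))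
      = (if n = l then 1 else 0)" for n l
    using arg_cong[OF S12[where n=n and l=l], of complex_of_real] by (auto split: if_splits)
  show ?thesis
    using S21 S12 lower_triangular_inversion[OF cS21 cS12]
      lower_triangular_transpose_inversion[OF cS21 cS12] by blast
qed

end
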